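(* Let $x_1=\sqrt[8]{3/5}$, let $\varepsilon$ be a real number with $0<\varepsilon\leqslant 1$, let $$V(\theta)=\frac{(7\theta^2-3)\,(\theta^2-1)^3}{3},\qquad v(x)=V\!\left(\frac{x}{x_1}\right),$$ and define $S:[0,+\infty)\to\mathbb{R}$ by $$S(x)=\begin{cases}6x^4\,(1-\varepsilon\,v(x)) & \text{if } 0\leqslant x<x_1,\\ 6x^4 & \text{if } x\geqslant x_1.\end{cases}$$ Then $S$ is a counterexample to Khabibullin's conjecture (in the original formulation for logarithmically convex functions, recalled in the context) for $n=2$ and $\lambda=4$. That is, $S$ is non-negative, non-decreasing on $[0,+\infty)$ and convex with respect to the logarithm, the inequality $$\int_0^1 S(tx)\,x\,dx\leqslant t^{4}$$ holds for all $0\leqslant t<+\infty$, but the inequality $$\int_0^{+\infty}S(t)\,\frac{t^{7}}{(1+t^{8})^2}\,dt\leqslant\frac{3\pi}{8}$$ does not hold.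
   Context: A function $S$ on $[0,+\infty)$ is called convex with respect to the logarithm if $\sigma(x)=S(e^x)$ is a convex function of $x\in\mathbb{R}$ in the usual sense, i.e. $\sigma(\alpha x+\beta y)\leqslant\alpha\sigma(x)+\beta\sigma(y)$ for all real $x,y$ and all $\alpha,\beta\geqslant 0$ with $\alpha+\beta=1$. Khabibullin's conjecture (original formulation): let $\lambda>0$ be real and let $n\geqslant 2$ be an integer. Let $S$ be a non-negative non-decreasing function on $[0,+\infty)$ that is convex with respect to the logarithm. If $\int_0^1 S(tx)(1-x^2)^{n-2}\,x\,dx\leqslant t^{\lambda}$ for all $0\leqslant t<+\infty$, then $\int_0^{+\infty}S(t)\,\frac{t^{2\lambda-1}}{(1+t^{2\lambda})^2}\,dt\leqslant\frac{\pi(n-1)}{2\lambda}\prod_{k=1}^{n-1}\bigl(1+\frac{\lambda}{2k}\bigr)$. A counterexample for given $n$ and $\lambda$ is a non-negative non-decreasing function $S$ on $[0,+\infty)$, convex with respect to the logarithm, satisfying the first inequality for all $t\geqslant 0$ but not satisfying the second one. For $n=2$, $\lambda=4$ the right-hand side of the second inequality equals $\frac{\pi}{8}(1+2)=\frac{3\pi}{8}$. *)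

theory Defs
  imports "HOL-Analysis.Analysis"
begin

definition log_convex :: "(real \<Rightarrow> real) \<Rightarrow> bool" where
  "log_convex S \<longleftrightarrow> convex_on UNIV (\<lambda>x. S (exp x))"

text \<open>
  A function on $[0,+\infty)$ is represented by a total function on the reals;
  only its values on \<open>{0..}\<close> are ever used below.

  For admissible functions all integrands are non-negative and Borel measurable, so the
  integrals are taken in the extended non-negative reals. In this way a divergent integral
  has the value \<open>\<infinity>\<close> and violates the upper bound, as it should, whereas a real-valued
  integral would give it a junk value.
\<close>

definition khabibullin_admissible :: "(real \<Rightarrow> real) \<Rightarrow> bool" where
  "khabibullin_admissible S \<longleftrightarrow>
     (\<forall>x\<ge>0. 0 \<le> S x) \<and> mono_on {0..} S \<and> log_convex S"

definition khabibullin_hypothesis :: "nat \<Rightarrow> real \<Rightarrow> (real \<Rightarrow> real) \<Rightarrow> bool" where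
  "khabibullin_hypothesis n lam S \<longleftrightarrow>
     (\<forall>t\<ge>0. (\<integral>\<^sup>+x\<in>{0..1}. ennreal (S (t * x) * (1 - x\<^sup>2) ^ (n - 2) * x) \<partial>lborel)
              \<le> ennreal (t powr lam))"

definition khabibullin_conclusion :: "nat \<Rightarrow> real \<Rightarrow> (real \<Rightarrow> real) \<Rightarrow> bool" where
  "khabibullin_conclusion n lam S \<longleftrightarrow>
     (\<integral>\<^sup>+t\<in>{0..}. ennreal (S t * (t powr (2 * lam - 1) / (1 + t powr (2 * lam))\<^sup>2)) \<partial>lborel)
       \<le> ennreal (pi * real (n - 1) / (2 * lam) * (\<Prod>k=1..n - 1. 1 + lam / (2 * real k)))"

definition khabibullin_counterexample :: "nat \<Rightarrow> real \<Rightarrow> (real \<Rightarrow> real) \<Rightarrow> bool" where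
  "khabibullin_counterexample n lam S \<longleftrightarrow>
     2 \<le> n \<and> 0 < lam \<and> khabibullin_admissible S \<and>
     khabibullin_hypothesis n lam S \<and> \<not> khabibullin_conclusion n lam S"

definition x1 :: real where
  "x1 = root 8 (3 / 5)"

definition V :: "real \<Rightarrow> real" where
  "V \<theta> = (7 * \<theta>\<^sup>2 - 3) * (\<theta>\<^sup>2 - 1) ^ 3 / 3"

definition v :: "real \<Rightarrow> real" where
  "v x = V (x / x1)"

text \<open>The values of \<open>S_eps \<epsilon>\<close> at negative arguments are irrelevant.\<close>

definition S_eps :: "real \<Rightarrow> real \<Rightarrow> real" where
  "S_eps \<epsilon> x = (if x < x1 then 6 * x ^ 4 * (1 - \<epsilon> * v x) else 6 * x ^ 4)"

end

theory Submission
  imports Defs "HOL-Real_Asymp.Real_Asymp"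
begin

text \<open>
  The function \<open>6 x\<^sup>4\<close> turns both inequalities of the conjecture into equalities, so an
  admissible perturbation of it violates the conjecture as soon as it lowers (or keeps) every mean on the
  left of the hypothesis while it raises the integral in the conclusion. The perturbation here
  subtracts \<open>6 \<epsilon> x\<^sup>4 v x\<close> on \<open>[0, x1)\<close>. Write \<open>u = (x / x1)\<^sup>2\<close>. What makes it work is that
  \[
     u^2\,(7u-3)(u-1)^3 = \frac{d}{du}\bigl(u^3 (1-u)^4\bigr)
  \]
  is the derivative of a non-negative function vanishing at both ends of \<open>[0, 1]\<close>.

  \<^item> Hypothesis: the mean of the perturbed function is \<open>t\<^sup>4 (1 - \<epsilon> (1 - u)\<^sup>4)\<close> for \<open>t < x1\<close>, where
    \<open>u\<close> is taken at \<open>t\<close>, and it is \<open>t\<^sup>4\<close> for \<open>t \<ge> x1\<close> (\<open>S_eps_mean_le\<close>).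

  \<^item> Conclusion: integrating by parts (\<open>perturbation_integration_by_parts\<close>) moves the derivative
    to the weight \<open>t\<^sup>6 / (1 + t\<^sup>8)\<^sup>2\<close>, which increases exactly as long as \<open>5 t\<^sup>8 < 3\<close>, that is,
    up to \<open>t = x1\<close>. So the integral gains a strictly positive amount (\<open>S_gap_head_integral_gt\<close>).

  \<^item> Shape: in the variable \<open>y = ln x\<close> the first two derivatives of the perturbed function are
    \<open>x\<^sup>4\<close> times positive constants times \<open>1 + \<epsilon> X\<close>, with \<open>X\<close> a polynomial in \<open>u\<close> on \<open>[0, 1]\<close> and
    zero beyond. The inequality \<open>X \<ge> -1\<close> is elementary
    (\<open>first_shape_polynomial_bound\<close>, \<open>second_shape_polynomial_bound\<close>), and \<open>\<epsilon> \<le> 1\<close> does the rest.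

  The zero of order three of \<open>v\<close> at \<open>x1\<close> makes the two pieces fit together twice differentiably.
  Replacing \<open>1 - u\<close> by its positive part \<open>gap u\<close> expresses this by single formulas, valid on both
  sides of \<open>x1\<close>, so that no junction of pieces has to be examined again.
\<close>

section \<open>Powers of a positive part\<close>

definition gap :: "real \<Rightarrow> real" where
  "gap w = max 0 (1 - w)"

lemma gap_nonneg: "0 \<le> gap w"
  by (simp add: gap_def)

lemma gap_le_1: "0 \<le> w \<Longrightarrow> gap w \<le> 1"
  by (simp add: gap_def)

text \<open>
  Polynomial identities involving \<open>gap\<close> are verified in these two cases: in the first one all terms
  with \<open>gap\<close> drop out, in the second one they are identities of ordinary polynomials.
\<close>

lemma gap_cases: "gap w = 0 \<or> gap w = 1 - w"
  by (auto simp: gap_def)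

lemma continuous_on_gap [continuous_intros]:
  "continuous_on A f \<Longrightarrow> continuous_on A (\<lambda>x. gap (f x))"
  unfolding gap_def by (intro continuous_intros)

text \<open>
  Only the point \<open>0\<close> needs an argument: there the difference quotient is at most
  \<open>\<bar>h\<bar> ^ Suc n\<close> in absolute value.
\<close>

lemma truncated_power_has_derivative:
  fixes z :: real
  shows "((\<lambda>z. max 0 z ^ Suc (Suc n)) has_real_derivative
           real (Suc (Suc n)) * max 0 z ^ Suc n) (at z)"
proof (cases z "0 :: real" rule: linorder_cases)
  case less
  have "((\<lambda>z. 0) has_real_derivative 0) (at z)" by simp
  then have "((\<lambda>z. max 0 z ^ Suc (Suc n)) has_real_derivative 0) (at z)"
    by (rule has_field_derivative_transform_within_open[where S = "{..<0}"]) (use less in auto)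
  then show ?thesis using less by simp
next
  case greater
  have "((\<lambda>z. z ^ Suc (Suc n)) has_real_derivative real (Suc (Suc n)) * z ^ Suc n) (at z)"
    using DERIV_pow[of "Suc (Suc n)" z] by simp
  then have "((\<lambda>z. max 0 z ^ Suc (Suc n)) has_real_derivative
      real (Suc (Suc n)) * z ^ Suc n) (at z)"
    by (rule has_field_derivative_transform_within_open[where S = "{0<..}"]) (use greater in auto)
  then show ?thesis using greater by simp
next
  case equal
  have "((\<lambda>h. max 0 h ^ Suc (Suc n) / h) \<longlongrightarrow> 0) (at (0::real))"
  proof (rule Lim_null_comparison)
    have "norm (max 0 h ^ Suc (Suc n) / h) \<le> \<bar>h\<bar> ^ Suc n" for h :: real
      by (cases h "0 :: real" rule: linorder_cases) (auto simp: abs_mult mult_nonpos_nonneg)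
    then show "eventually (\<lambda>h. norm (max 0 h ^ Suc (Suc n) / h) \<le> \<bar>h\<bar> ^ Suc n) (at (0::real))"
      by (rule always_eventually[OF allI])
    have "((\<lambda>h::real. \<bar>h\<bar> ^ Suc n) \<longlongrightarrow> \<bar>0\<bar> ^ Suc n) (at 0)"
      by (intro tendsto_intros)
    then show "((\<lambda>h::real. \<bar>h\<bar> ^ Suc n) \<longlongrightarrow> 0) (at 0)" by simp
  qed
  then show ?thesis using equal by (simp add: DERIV_def)
qed

lemma gap_power_derivatives:
  assumes "(f has_real_derivative f') (at z)"
  shows "((\<lambda>z. gap (f z) ^ 2) has_real_derivative - 2 * gap (f z) * f') (at z)"
    and "((\<lambda>z. gap (f z) ^ 3) has_real_derivative - 3 * gap (f z) ^ 2 * f') (at z)"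
    and "((\<lambda>z. gap (f z) ^ 4) has_real_derivative - 4 * gap (f z) ^ 3 * f') (at z)"
proof -
  have "((\<lambda>z. 1 - f z) has_real_derivative - f') (at z)"
    using assms by (auto intro!: derivative_eq_intros)
  note chain = DERIV_chain2[OF truncated_power_has_derivative this]
  show "((\<lambda>z. gap (f z) ^ 2) has_real_derivative - 2 * gap (f z) * f') (at z)"
    and "((\<lambda>z. gap (f z) ^ 3) has_real_derivative - 3 * gap (f z) ^ 2 * f') (at z)"
    and "((\<lambda>z. gap (f z) ^ 4) has_real_derivative - 4 * gap (f z) ^ 3 * f') (at z)"
    using chain[of 0] chain[of 1] chain[of 2] by (simp_all add: gap_def numeral_eq_Suc)
qed

section \<open>The function without a case distinction\<close>

lemma x1_pos: "0 < x1"
  by (simp add: x1_def)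

lemma x1_power8: "x1 ^ 8 = 3 / 5"
  by (simp add: x1_def)

definition S_gap :: "real \<Rightarrow> real \<Rightarrow> real" where
  "S_gap \<epsilon> x = 6 * x ^ 4 * (1 + \<epsilon> * ((7 * (x / x1)\<^sup>2 - 3) * gap ((x / x1)\<^sup>2) ^ 3 / 3))"

lemma S_eps_eq_S_gap:
  assumes "0 \<le> x"
  shows "S_eps \<epsilon> x = S_gap \<epsilon> x"
proof (cases "x < x1")
  case True
  then have "x / x1 < 1" "0 \<le> x / x1" using x1_pos assms by auto
  then have "(x / x1)\<^sup>2 \<le> 1" by (simp add: power_le_one)
  then have gap: "gap ((x / x1)\<^sup>2) = - ((x / x1)\<^sup>2 - 1)" by (simp add: gap_def)
  have "gap ((x / x1)\<^sup>2) ^ 3 = - (((x / x1)\<^sup>2 - 1) ^ 3)"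
    unfolding gap by (rule power_minus_odd) simp
  then show ?thesis using True by (simp add: S_eps_def S_gap_def v_def V_def)
next
  case False
  then have "1 \<le> x / x1" using x1_pos by auto
  then have "1 \<le> (x / x1)\<^sup>2" by (simp add: one_le_power)
  then show ?thesis using False by (simp add: S_eps_def S_gap_def gap_def)
qed

lemma continuous_on_S_gap [continuous_intros]:
  "continuous_on A f \<Longrightarrow> continuous_on A (\<lambda>x. S_gap \<epsilon> (f x))"
  unfolding S_gap_def using x1_pos by (intro continuous_intros) auto

text \<open>
  The only place where the size of \<open>\<epsilon>\<close> matters: non-negativity, monotonicity and convexity are all
  instances of it.
\<close>

lemma one_plus_eps_mult_nonneg:
  fixes \<epsilon> :: real
  assumes "0 < \<epsilon>" "\<epsilon> \<le> 1" "- 1 \<le> X"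
  shows "0 \<le> 1 + \<epsilon> * X"
proof -
  have "\<epsilon> * (- 1) \<le> \<epsilon> * X" using assms by (intro mult_left_mono) auto
  then show ?thesis using assms by simp
qed

lemma S_gap_nonneg:
  assumes "0 < \<epsilon>" "\<epsilon> \<le> 1"
  shows "0 \<le> S_gap \<epsilon> x"
proof -
  define w where "w = (x / x1)\<^sup>2"
  have w: "0 \<le> w" by (simp add: w_def)
  have "- 3 * 1 \<le> (- 3) * gap w ^ 3"
    using gap_nonneg gap_le_1[OF w] by (simp add: power_le_one)
  also have "\<dots> \<le> (7 * w - 3) * gap w ^ 3"
    using w gap_nonneg by (intro mult_right_mono) auto
  finally have "- 1 \<le> (7 * w - 3) * gap w ^ 3 / 3" by simp
  from one_plus_eps_mult_nonneg[OF assms this] show ?thesis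
    by (simp add: S_gap_def w_def)
qed

section \<open>Monotonicity and logarithmic convexity\<close>

text \<open>
  Differentiation in \<open>y\<close> is \<open>2 w d/dw\<close> in terms of \<open>w\<close>, hence it preserves polynomials in \<open>w\<close> and
  \<open>gap w\<close>. Each differentiation costs one power of \<open>gap w\<close>, and the second derivative is still
  continuous. The factors are written as \<open>1 + \<epsilon> * X\<close> to match \<open>one_plus_eps_mult_nonneg\<close>.
\<close>

lemma S_gap_exp_derivatives:
  fixes \<epsilon> y :: real
  defines "w \<equiv> \<lambda>y. (exp y / x1)\<^sup>2"
  defines "\<sigma>' \<equiv> \<lambda>y. 24 * x1 ^ 4 * (w y ^ 2 * (1 + \<epsilon> * - ((7 * w y ^ 2 - 6 * w y + 1) * gap (w y) ^ 2)))"
  shows "((\<lambda>y. S_gap \<epsilon> (exp y)) has_real_derivative \<sigma>' y) (at y)"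
    and "(\<sigma>' has_real_derivative 96 * x1 ^ 4 * (w y ^ 2 *
             (1 + \<epsilon> * ((21 * w y ^ 3 - 29 * w y ^ 2 + 11 * w y - 1) * gap (w y))))) (at y)"
proof -
  have dw: "(w has_real_derivative 2 * w z) (at z)" for z
    unfolding w_def using x1_pos
    by (auto intro!: derivative_eq_intros simp: power2_eq_square field_simps)
  have S: "S_gap \<epsilon> (exp z) = 2 * x1 ^ 4 * (w z ^ 2 * (3 + \<epsilon> * ((7 * w z - 3) * gap (w z) ^ 3)))" for z
  proof -
    have "exp z ^ 4 = x1 ^ 4 * w z ^ 2"
      unfolding w_def using x1_pos by (simp add: field_simps flip: power_mult)
    moreover have "6 * a * (1 + \<epsilon> * (r / 3)) = 2 * a * (3 + \<epsilon> * r)" for a r :: real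
      by (simp add: field_simps)
    ultimately show ?thesis by (simp add: S_gap_def w_def)
  qed
  \<comment> \<open>The rules for powers of \<open>gap\<close> must be tried before the general power rule, which would ask for the
      derivative of \<open>gap\<close> itself; that one does not exist at \<open>1\<close>.\<close>
  note deriv_rules = gap_power_derivatives[OF dw] dw
  show "((\<lambda>y. S_gap \<epsilon> (exp y)) has_real_derivative \<sigma>' y) (at y)"
  proof -
    have "(42 * u - 12) * g ^ 3 - 6 * u * (7 * u - 3) * g ^ 2 = 12 * - ((7 * u ^ 2 - 6 * u + 1) * g ^ 2)"
      if "g = 0 \<or> g = 1 - u" for u g :: real
      using that
    proof
      assume "g = 1 - u"
      then have u: "u = 1 - g" by simp
      show ?thesis unfolding u by (simp add: algebra_simps power_numeral_reduce)
    qed simp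
    note cancel = this[OF gap_cases]
    have "((\<lambda>y. S_gap \<epsilon> (exp y)) has_real_derivative 2 * x1 ^ 4 * (w y ^ 2 *
        (12 + \<epsilon> * ((42 * w y - 12) * gap (w y) ^ 3 - 6 * w y * (7 * w y - 3) * gap (w y) ^ 2)))) (at y)"
      unfolding S
      apply (rule deriv_rules | rule derivative_eq_intros refl)+
      apply (simp add: algebra_simps power_numeral_reduce)
      done
    then show ?thesis unfolding cancel \<sigma>'_def by (simp add: algebra_simps)
  qed
  show "(\<sigma>' has_real_derivative 96 * x1 ^ 4 * (w y ^ 2 *
             (1 + \<epsilon> * ((21 * w y ^ 3 - 29 * w y ^ 2 + 11 * w y - 1) * gap (w y))))) (at y)"
  proof -
    have "u * (7 * u ^ 2 - 6 * u + 1) * g - (14 * u ^ 2 - 9 * u + 1) * g ^ 2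
        = (21 * u ^ 3 - 29 * u ^ 2 + 11 * u - 1) * g"
      if "g = 0 \<or> g = 1 - u" for u g :: real
      using that
    proof
      assume "g = 1 - u"
      then have u: "u = 1 - g" by simp
      show ?thesis unfolding u by (simp add: algebra_simps power_numeral_reduce)
    qed simp
    note cancel = this[OF gap_cases]
    have "(\<sigma>' has_real_derivative 96 * x1 ^ 4 * (w y ^ 2 * (1 + \<epsilon> *
        (w y * (7 * w y ^ 2 - 6 * w y + 1) * gap (w y) - (14 * w y ^ 2 - 9 * w y + 1) * gap (w y) ^ 2)))) (at y)"
      unfolding \<sigma>'_def
      apply (rule deriv_rules | rule derivative_eq_intros refl)+
      apply (simp add: algebra_simps power_numeral_reduce)
      done
    then show ?thesis unfolding cancel .
  qed
qed

text \<open>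
  For \<open>w \<le> 1\<close> the difference of the two sides has the factor \<open>w\<close>; the cofactor is visibly positive when
  expanded in powers of \<open>s = 1 - w\<close>.
\<close>

lemma first_shape_polynomial_bound:
  assumes "0 \<le> w"
  shows "- 1 \<le> - ((7 * w ^ 2 - 6 * w + 1) * gap w ^ 2)"
proof (cases "w \<le> 1")
  case True
  define s where "s = 1 - w"
  have s: "0 \<le> s" "s \<le> 1" using True assms by (auto simp: s_def)
  have "0 \<le> w * (1 + s * (1 - s) + 7 * s ^ 3)"
    using assms s by (intro mult_nonneg_nonneg add_nonneg_nonneg) auto
  also have "\<dots> = 1 - (7 * w ^ 2 - 6 * w + 1) * (1 - w) ^ 2"
    unfolding s_def by algebra
  finally show ?thesis using True by (simp add: gap_def)
qed (simp add: gap_def)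

text \<open>
  The same expansion as for the first derivative; the cofactor is now
  \<open>1 + s (21 s\<^sup>2 - 13 s + 3)\<close>, whose quadratic factor has negative discriminant.
\<close>

lemma second_shape_polynomial_bound:
  assumes "0 \<le> w"
  shows "- 1 \<le> (21 * w ^ 3 - 29 * w ^ 2 + 11 * w - 1) * gap w"
proof (cases "w \<le> 1")
  case True
  define s where "s = 1 - w"
  have s: "0 \<le> s" using True by (simp add: s_def)
  have "21 * s ^ 2 - 13 * s + 3 = 21 * (s - 13 / 42) ^ 2 + 83 / 84"
    by (simp add: power2_eq_square field_simps)
  then have "0 \<le> 21 * s ^ 2 - 13 * s + 3" by (simp add: add_nonneg_nonneg)
  then have "0 \<le> w * (1 + s * (21 * s ^ 2 - 13 * s + 3))"
    using assms s by (intro mult_nonneg_nonneg add_nonneg_nonneg[OF zero_le_one])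
  also have "\<dots> = 1 + (21 * w ^ 3 - 29 * w ^ 2 + 11 * w - 1) * (1 - w)"
    unfolding s_def by algebra
  finally show ?thesis using True by (simp add: gap_def)
qed (simp add: gap_def)

lemma S_eps_exp: "S_eps \<epsilon> (exp y) = S_gap \<epsilon> (exp y)"
  by (simp add: S_eps_eq_S_gap)

lemma S_eps_log_convex:
  assumes "0 < \<epsilon>" "\<epsilon> \<le> 1"
  shows "log_convex (S_eps \<epsilon>)"
  unfolding log_convex_def S_eps_exp
proof (rule f''_ge0_imp_convex[OF convex_UNIV S_gap_exp_derivatives])
  fix y :: real
  show "0 \<le> 96 * x1 ^ 4 * (((exp y / x1)\<^sup>2) ^ 2 * (1 + \<epsilon> *
      ((21 * ((exp y / x1)\<^sup>2) ^ 3 - 29 * ((exp y / x1)\<^sup>2) ^ 2 + 11 * (exp y / x1)\<^sup>2 - 1) * gap ((exp y / x1)\<^sup>2))))"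
    by (intro mult_nonneg_nonneg one_plus_eps_mult_nonneg[OF assms] second_shape_polynomial_bound) auto
qed

text \<open>
  The substitution \<open>x = exp y\<close> reaches only \<open>x > 0\<close>. At \<open>0\<close> the function vanishes, which is its
  least possible value.
\<close>

lemma S_eps_mono:
  assumes "0 < \<epsilon>" "\<epsilon> \<le> 1"
  shows "mono_on {0..} (S_eps \<epsilon>)"
proof (rule mono_onI)
  fix a b :: real
  assume ab: "a \<in> {0..}" "b \<in> {0..}" "a \<le> b"
  show "S_eps \<epsilon> a \<le> S_eps \<epsilon> b"
  proof (cases "a = 0")
    case True
    then have "S_eps \<epsilon> a = 0" by (simp add: S_eps_def)
    then show ?thesis using S_gap_nonneg[OF assms] ab by (simp add: S_eps_eq_S_gap)
  next
    case False
    then have pos: "0 < a" "0 < b" using ab by auto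
    have "S_gap \<epsilon> (exp (ln a)) \<le> S_gap \<epsilon> (exp (ln b))"
    proof (rule DERIV_nonneg_imp_nondecreasing[where f = "\<lambda>y. S_gap \<epsilon> (exp y)"])
      show "ln a \<le> ln b" using pos ab by simp
      fix y
      show "\<exists>d. ((\<lambda>y. S_gap \<epsilon> (exp y)) has_real_derivative d) (at y) \<and> 0 \<le> d"
        by (intro exI conjI, rule S_gap_exp_derivatives(1))
          (intro mult_nonneg_nonneg one_plus_eps_mult_nonneg[OF assms] first_shape_polynomial_bound, auto)
    qed
    then show ?thesis using pos by (simp add: S_eps_eq_S_gap)
  qed
qed

section \<open>The hypothesis of the conjecture\<close>

text \<open>
  The integrand has the antiderivative \<open>F\<close> below. The correction in \<open>F\<close> comes from the
  antiderivative \<open>u\<^sup>3 (1 - u)\<^sup>4 / 3\<close> of \<open>u\<^sup>2 (7 u - 3) (u - 1)\<^sup>3 / 3\<close>, and it has a sign.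
\<close>

lemma S_eps_mean_le:
  assumes "0 < \<epsilon>" "\<epsilon> \<le> 1" "0 \<le> t"
  shows "(\<integral>\<^sup>+x\<in>{0..1}. ennreal (S_eps \<epsilon> (t * x) * x) \<partial>lborel) \<le> ennreal (t ^ 4)"
proof -
  define c where "c = (t / x1)\<^sup>2"
  define F where "F = (\<lambda>x. t ^ 4 * (x ^ 6 * (1 - \<epsilon> * gap (c * x\<^sup>2) ^ 4)))"
  have "(\<integral>\<^sup>+x\<in>{0..1}. ennreal (S_eps \<epsilon> (t * x) * x) \<partial>lborel)
      = (\<integral>\<^sup>+x\<in>{0..1}. ennreal (S_gap \<epsilon> (t * x) * x) \<partial>lborel)"
    using \<open>0 \<le> t\<close> by (intro nn_integral_cong) (auto simp: S_eps_eq_S_gap indicator_def)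
  also have "\<dots> = ennreal (F 1 - F 0)"
  proof (rule nn_integral_FTC_Icc[where F = F and f = "\<lambda>x. S_gap \<epsilon> (t * x) * x"])
    show "(\<lambda>x. S_gap \<epsilon> (t * x) * x) \<in> borel_measurable borel"
      by (intro borel_measurable_continuous_onI continuous_intros)
    fix x :: real
    assume x: "x \<in> {0..1}"
    show "0 \<le> S_gap \<epsilon> (t * x) * x"
      using x S_gap_nonneg[OF assms(1,2)] by simp
    have d: "((\<lambda>x. c * x\<^sup>2) has_real_derivative 2 * c * x) (at x)"
      by (auto intro!: derivative_eq_intros)
    show "(F has_real_derivative S_gap \<epsilon> (t * x) * x) (at x)"
      unfolding F_def S_gap_def times_divide_eq_left[symmetric] power_mult_distrib c_def[symmetric]
      apply (rule gap_power_derivatives[OF d] | rule derivative_eq_intros refl)+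
      using gap_cases[of "c * x\<^sup>2"]
      apply (elim disjE)
       apply (simp add: power_numeral_reduce)
      apply (simp only:)
      apply (simp add: field_simps power_numeral_reduce)
      done
  qed simp
  also have "F 1 - F 0 \<le> t ^ 4"
    using assms by (simp add: F_def mult_left_le gap_nonneg)
  finally show ?thesis by (simp add: ennreal_leI)
qed

section \<open>The failure of the conclusion\<close>

lemma one_plus_power8_nonzero: "1 + (t::real) ^ 8 \<noteq> 0"
  using zero_le_even_power[of 8 t] by (simp add: add_nonneg_eq_0_iff)

text \<open>
  This is the integrand of the conclusion for the unperturbed function \<open>6 t\<^sup>4\<close>; the
  substitution \<open>z = t\<^sup>4\<close> turns it into a multiple of \<open>z\<^sup>2 / (1 + z\<^sup>2)\<^sup>2\<close>.
\<close>

lemma main_term_has_derivative: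
  "((\<lambda>t. 3 / 4 * (arctan (t ^ 4) - t ^ 4 / (1 + t ^ 8))) has_real_derivative
      6 * t ^ 11 / (1 + t ^ 8)\<^sup>2) (at t)"
proof -
  have "((\<lambda>t. t ^ 4 / (1 + t ^ 8)) has_real_derivative
      (4 * t ^ 3 * (1 + t ^ 8) - t ^ 4 * (8 * t ^ 7)) / ((1 + t ^ 8) * (1 + t ^ 8))) (at t)"
    by (auto intro!: derivative_eq_intros simp: one_plus_power8_nonzero)
  moreover have "((\<lambda>t. arctan (t ^ 4)) has_real_derivative 4 * t ^ 3 / (1 + t ^ 8)) (at t)"
    using DERIV_chain2[OF DERIV_arctan DERIV_pow[of 4 t]]
    by (simp add: divide_inverse mult.commute flip: power_mult)
  ultimately have "((\<lambda>t. 3 / 4 * (arctan (t ^ 4) - t ^ 4 / (1 + t ^ 8))) has_real_derivative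
      3 / 4 * (4 * t ^ 3 / (1 + t ^ 8) -
        (4 * t ^ 3 * (1 + t ^ 8) - t ^ 4 * (8 * t ^ 7)) / ((1 + t ^ 8) * (1 + t ^ 8)))) (at t)"
    by (intro DERIV_cmult DERIV_diff)
  moreover have combine: "3 / 4 * (4 * t ^ 3 / d - (4 * t ^ 3 * d - t ^ 4 * (8 * t ^ 7)) / (d * d))
      = 6 * t ^ 11 / d\<^sup>2" if "d \<noteq> 0" for d
    using that by (simp add: diff_divide_distrib power2_eq_square algebra_simps flip: power_add)
  ultimately show ?thesis unfolding combine[OF one_plus_power8_nonzero] by simp
qed

text \<open>
  The bound of the conjecture is attained by \<open>6 t\<^sup>4\<close>, the antiderivative being zero at \<open>0\<close>.
\<close>

lemma main_term_tendsto:
  "((\<lambda>t::real. 3 / 4 * (arctan (t ^ 4) - t ^ 4 / (1 + t ^ 8))) \<longlongrightarrow> 3 * pi / 8) at_top"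
  by real_asymp

text \<open>
  The product differentiated here is \<open>-3 x1\<^sup>6\<close> times \<open>u\<^sup>3 (1 - u)\<^sup>4 / 3\<close> (truncated, with
  \<open>u = (t / x1)\<^sup>2\<close>) times the weight \<open>t\<^sup>6 / (1 + t\<^sup>8)\<^sup>2\<close>. The first term of its derivative is
  the contribution of the perturbation to the integrand of the conclusion. The subtracted term stems
  from the derivative of the weight and has the sign of \<open>6 - 10 t\<^sup>8\<close>,
  which changes at \<open>x1\<close>.
\<close>

lemma perturbation_integration_by_parts:
  "((\<lambda>t. - (t ^ 12 * gap ((t / x1)\<^sup>2) ^ 4 / (1 + t ^ 8)\<^sup>2)) has_real_derivative
      6 * t ^ 11 * ((7 * (t / x1)\<^sup>2 - 3) * gap ((t / x1)\<^sup>2) ^ 3 / 3) / (1 + t ^ 8)\<^sup>2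
      - t ^ 11 * gap ((t / x1)\<^sup>2) ^ 4 * (6 - 10 * t ^ 8) / (1 + t ^ 8) ^ 3) (at t)"
proof -
  define c where "c = 1 / x1\<^sup>2"
  have c: "(t / x1)\<^sup>2 = c * t\<^sup>2" for t
    by (simp add: c_def power_divide)
  have gap: "((\<lambda>t. gap (c * t\<^sup>2) ^ 4) has_real_derivative - 4 * gap (c * t\<^sup>2) ^ 3 * (2 * c * t)) (at t)"
    by (rule gap_power_derivatives) (auto intro!: derivative_eq_intros)
  have weight: "((\<lambda>t. t ^ 12 / (1 + t ^ 8)\<^sup>2) has_real_derivative
      t ^ 11 * (12 - 4 * t ^ 8) / (1 + t ^ 8) ^ 3) (at t)"
  proof -
    have "((\<lambda>t. t ^ 12 / (1 + t ^ 8)\<^sup>2) has_real_derivative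
        (12 * t ^ 11 * (1 + t ^ 8)\<^sup>2 - t ^ 12 * (2 * (1 + t ^ 8) * (8 * t ^ 7)))
          / ((1 + t ^ 8)\<^sup>2 * (1 + t ^ 8)\<^sup>2)) (at t)"
      by (auto intro!: derivative_eq_intros simp: one_plus_power8_nonzero)
    also have "12 * t ^ 11 * (1 + t ^ 8)\<^sup>2 - t ^ 12 * (2 * (1 + t ^ 8) * (8 * t ^ 7))
        = (1 + t ^ 8) * (t ^ 11 * (12 - 4 * t ^ 8))"
      by algebra
    also have "(1 + t ^ 8)\<^sup>2 * (1 + t ^ 8)\<^sup>2 = (1 + t ^ 8) * (1 + t ^ 8) ^ 3"
      by algebra
    finally show ?thesis by (simp add: one_plus_power8_nonzero)
  qed
  \<comment> \<open>The identity behind the claim, with \<open>a = t ^ 11\<close>, \<open>s = t ^ 8\<close> and \<open>u = c * t\<^sup>2\<close>; as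
      independent variables they keep the degrees low.\<close>
  have poly: "- (a * (12 - 4 * s) / (1 + s) ^ 3 * g ^ 4 - 8 * g ^ 3 * u * a / (1 + s)\<^sup>2)
      = 6 * a * ((7 * u - 3) * g ^ 3 / 3) / (1 + s)\<^sup>2 - a * g ^ 4 * (6 - 10 * s) / (1 + s) ^ 3"
    if nz: "1 + s \<noteq> 0" and g: "g = 0 \<or> g = 1 - u" for a s u g :: real
  proof -
    have sq: "x / (1 + s)\<^sup>2 = x * (1 + s) / (1 + s) ^ 3" for x
      using nz by (simp add: power2_eq_square power3_eq_cube)
    have "- (a * (12 - 4 * s) / (1 + s) ^ 3 * g ^ 4 - 8 * g ^ 3 * u * a / (1 + s)\<^sup>2)
        = - (a * (12 - 4 * s) * g ^ 4 - 8 * g ^ 3 * u * a * (1 + s)) / (1 + s) ^ 3"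
      unfolding sq by (simp only: minus_divide_left[symmetric] diff_divide_distrib times_divide_eq_left)
    also have "- (a * (12 - 4 * s) * g ^ 4 - 8 * g ^ 3 * u * a * (1 + s))
        = 2 * a * (7 * u - 3) * g ^ 3 * (1 + s) - a * g ^ 4 * (6 - 10 * s)"
      using g
    proof
      assume "g = 1 - u"
      then have u: "u = 1 - g" by simp
      show ?thesis unfolding u by (simp add: algebra_simps power_numeral_reduce)
    qed simp
    finally show ?thesis by (simp add: sq diff_divide_distrib)
  qed
  have reorder: "t ^ 12 / d * (- 4 * g * (2 * c * t)) = - (8 * g * (c * t\<^sup>2) * t ^ 11 / d)" for g d
    by (simp add: power_numeral_reduce)
  have "((\<lambda>t. - (t ^ 12 / (1 + t ^ 8)\<^sup>2 * gap (c * t\<^sup>2) ^ 4)) has_real_derivative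
      - (t ^ 11 * (12 - 4 * t ^ 8) / (1 + t ^ 8) ^ 3 * gap (c * t\<^sup>2) ^ 4
        - 8 * gap (c * t\<^sup>2) ^ 3 * (c * t\<^sup>2) * t ^ 11 / (1 + t ^ 8)\<^sup>2)) (at t)"
    using DERIV_minus[OF DERIV_mult'[OF weight gap]] unfolding reorder by simp
  then show ?thesis
    unfolding c poly[OF one_plus_power8_nonzero gap_cases] by (simp only: times_divide_eq_left)
qed

text \<open>
  The left side is the same integral for \<open>6 t\<^sup>4\<close>. The boundary terms \<open>P\<close> of the integration by parts
  vanish at \<open>0\<close> and \<open>x1\<close>, so the two integrals differ by \<open>\<epsilon>\<close> times the integral of \<open>N\<close>, and
  \<open>N > 0\<close> inside the interval because \<open>10 * x1 ^ 8 = 6\<close>.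
\<close>

lemma S_gap_head_integral_gt:
  assumes "0 < \<epsilon>" "\<epsilon> \<le> 1"
  shows "3 / 4 * (arctan (x1 ^ 4) - x1 ^ 4 / (1 + x1 ^ 8))
    < integral {0..x1} (\<lambda>t. S_gap \<epsilon> t * (t ^ 7 / (1 + t ^ 8)\<^sup>2))"
proof -
  define A where "A = (\<lambda>t::real. 3 / 4 * (arctan (t ^ 4) - t ^ 4 / (1 + t ^ 8)))"
  define P where "P = (\<lambda>t. - (t ^ 12 * gap ((t / x1)\<^sup>2) ^ 4 / (1 + t ^ 8)\<^sup>2))"
  define N where "N = (\<lambda>t. t ^ 11 * gap ((t / x1)\<^sup>2) ^ 4 * (6 - 10 * t ^ 8) / (1 + t ^ 8) ^ 3)"
  define f where "f = (\<lambda>t. S_gap \<epsilon> t * (t ^ 7 / (1 + t ^ 8)\<^sup>2))"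
  note nz = one_plus_power8_nonzero
  have f: "f t = 6 * t ^ 11 / (1 + t ^ 8)\<^sup>2 + \<epsilon> * (6 * t ^ 11 *
      ((7 * (t / x1)\<^sup>2 - 3) * gap ((t / x1)\<^sup>2) ^ 3 / 3) / (1 + t ^ 8)\<^sup>2)" for t
  proof -
    have "6 * t ^ 4 * (1 + \<epsilon> * r) * (t ^ 7 / d) = 6 * t ^ 11 / d + \<epsilon> * (6 * t ^ 11 * r / d)" for r d
      by (simp add: algebra_simps add_divide_distrib flip: power_add)
    then show ?thesis unfolding f_def S_gap_def .
  qed
  have "((\<lambda>t. A t + \<epsilon> * P t) has_real_derivative f t - \<epsilon> * N t) (at t)" for t
  proof -
    have "((\<lambda>t. A t + \<epsilon> * P t) has_real_derivative 6 * t ^ 11 / (1 + t ^ 8)\<^sup>2 + \<epsilon> * (6 * t ^ 11 *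
      ((7 * (t / x1)\<^sup>2 - 3) * gap ((t / x1)\<^sup>2) ^ 3 / 3) / (1 + t ^ 8)\<^sup>2 - N t)) (at t)"
      unfolding A_def P_def N_def
      by (intro DERIV_add DERIV_cmult main_term_has_derivative perturbation_integration_by_parts)
    then show ?thesis by (simp only: f right_diff_distrib add_diff_eq)
  qed
  then have "((\<lambda>t. f t - \<epsilon> * N t) has_integral (A x1 + \<epsilon> * P x1) - (A 0 + \<epsilon> * P 0)) {0..x1}"
    using x1_pos
    by (intro fundamental_theorem_of_calculus)
      (auto simp: has_real_derivative_iff_has_vector_derivative[symmetric]
        intro: has_field_derivative_at_within)
  moreover have "A 0 = 0" "P 0 = 0" "P x1 = 0"
    using x1_pos by (auto simp: A_def P_def gap_def)
  ultimately have "A x1 = integral {0..x1} (\<lambda>t. f t - \<epsilon> * N t)"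
    by (simp add: integral_unique)
  also have "\<dots> < integral {0..x1} f"
  proof (rule integral_less_real)
    show "continuous_on {0..x1} f"
      unfolding f_def using nz by (intro continuous_intros) auto
    then show "continuous_on {0..x1} (\<lambda>t. f t - \<epsilon> * N t)"
      unfolding N_def using nz x1_pos by (intro continuous_intros) auto
    show "{0<..<x1} \<noteq> {}" using x1_pos by simp
    fix t
    assume t: "t \<in> {0<..<x1}"
    then have "t ^ 8 < x1 ^ 8" by (intro power_strict_mono) auto
    then have "0 < 6 - 10 * t ^ 8" by (simp add: x1_power8)
    moreover have "(t / x1)\<^sup>2 < 1" using t by (simp add: power_less_one_iff)
    then have "0 < gap ((t / x1)\<^sup>2)" by (simp add: gap_def)
    moreover have "0 < 1 + t ^ 8" by (simp add: add_pos_nonneg)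
    ultimately have "0 < N t" using t by (simp add: N_def)
    then show "f t - \<epsilon> * N t < f t" using assms by simp
  qed
  finally show ?thesis by (simp add: A_def f_def)
qed

text \<open>
  Beyond \<open>x1\<close> nothing has changed: the tail is evaluated by the antiderivative \<open>A\<close> and completes the
  gain on \<open>[0, x1]\<close> to a violation of the bound.
\<close>

lemma S_eps_integral_gt:
  assumes "0 < \<epsilon>" "\<epsilon> \<le> 1"
  shows "ennreal (3 * pi / 8) < (\<integral>\<^sup>+t\<in>{0..}. ennreal (S_eps \<epsilon> t * (t ^ 7 / (1 + t ^ 8)\<^sup>2)) \<partial>lborel)"
proof -
  define A where "A = (\<lambda>t::real. 3 / 4 * (arctan (t ^ 4) - t ^ 4 / (1 + t ^ 8)))"
  define f where "f = (\<lambda>t. S_gap \<epsilon> t * (t ^ 7 / (1 + t ^ 8)\<^sup>2))"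
  define g where "g = (\<lambda>t::real. 6 * t ^ 11 / (1 + t ^ 8)\<^sup>2)"
  note nz = one_plus_power8_nonzero
  have f_nonneg: "0 \<le> f t" if "0 \<le> t" for t
    using that S_gap_nonneg[OF assms] by (simp add: f_def)
  have f_cont: "continuous_on X f" for X
    unfolding f_def using nz by (intro continuous_intros) auto
  have g_cont: "continuous_on X g" for X
    unfolding g_def using nz by (intro continuous_intros) auto
  have [measurable]: "f \<in> borel_measurable borel" "g \<in> borel_measurable borel"
    by (auto intro: borel_measurable_continuous_onI f_cont g_cont)
  have head: "(\<integral>\<^sup>+t\<in>{0..x1}. ennreal (f t) \<partial>lborel) = ennreal (integral {0..x1} f)"
  proof -
    have "(f has_integral integral {0..x1} f) {0..x1}"
      by (intro integrable_integral integrable_continuous_real f_cont)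
    then have "(\<integral>\<^sup>+t. ennreal (indicator {0..x1} t * f t) \<partial>lborel) = ennreal (integral {0..x1} f)"
      by (intro nn_integral_has_integral_lebesgue) (use f_nonneg in auto)
    then show ?thesis by (simp add: nn_integral_set_ennreal mult.commute)
  qed
  have tail: "(\<integral>\<^sup>+t\<in>{x1..}. ennreal (g t) \<partial>lborel) = ennreal (3 * pi / 8 - A x1)"
  proof (rule nn_integral_FTC_atLeast)
    show "(A has_real_derivative g t) (at t)" for t
      unfolding A_def g_def by (rule main_term_has_derivative)
    show "(A \<longlongrightarrow> 3 * pi / 8) at_top"
      unfolding A_def by (rule main_term_tendsto)
    show "0 \<le> g t" if "x1 \<le> t" for t
      using that x1_pos by (simp add: g_def)
  qed simp
  \<comment> \<open>Needed because \<open>ennreal\<close> truncates negative numbers and is additive only on non-negative ones.\<close>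
  have tail_nonneg: "0 \<le> 3 * pi / 8 - A x1"
  proof -
    have bound: "0 \<le> 3 * pi / 8 - 3 / 4 * (a - b)" if "0 \<le> b" "a < pi / 2" for a b
      using that by (simp add: field_simps)
    show ?thesis unfolding A_def
      by (rule bound[OF _ arctan_ubound]) (use x1_pos in simp)
  qed
  have "A x1 < integral {0..x1} f"
    unfolding A_def f_def by (rule S_gap_head_integral_gt[OF assms])
  moreover have "0 \<le> integral {0..x1} f"
    using f_nonneg by (intro integral_nonneg integrable_continuous_real f_cont) auto
  ultimately have "ennreal (3 * pi / 8) < ennreal (integral {0..x1} f) + ennreal (3 * pi / 8 - A x1)"
    using tail_nonneg by (simp add: ennreal_plus[symmetric] ennreal_less_iff del: ennreal_plus)
  also have "\<dots> = (\<integral>\<^sup>+t. ennreal (f t) * indicator {0..x1} t + ennreal (g t) * indicator {x1..} t \<partial>lborel)"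
    unfolding head[symmetric] tail[symmetric] by (rule nn_integral_add[symmetric]) measurable
  also have "\<dots> \<le> (\<integral>\<^sup>+t\<in>{0..}. ennreal (S_eps \<epsilon> t * (t ^ 7 / (1 + t ^ 8)\<^sup>2)) \<partial>lborel)"
  \<comment> \<open>The two closed pieces overlap in \<open>x1\<close>, where the sum of the integrands is too large; hence the
      comparison holds only almost everywhere.\<close>
  proof (rule nn_integral_mono_AE)
    have tail_eq: "S_eps \<epsilon> t * (t ^ 7 / (1 + t ^ 8)\<^sup>2) = g t" if "x1 < t" for t
      using that by (simp add: S_eps_def g_def flip: power_add)
    have "ennreal (f t) * indicator {0..x1} t + ennreal (g t) * indicator {x1..} t
        \<le> ennreal (S_eps \<epsilon> t * (t ^ 7 / (1 + t ^ 8)\<^sup>2)) * indicator {0..} t" if "t \<noteq> x1" for t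
      using that tail_eq x1_pos by (auto simp: f_def S_eps_eq_S_gap split: split_indicator)
    then show "AE t in lborel. ennreal (f t) * indicator {0..x1} t + ennreal (g t) * indicator {x1..} t
        \<le> ennreal (S_eps \<epsilon> t * (t ^ 7 / (1 + t ^ 8)\<^sup>2)) * indicator {0..} t"
      using AE_lborel_singleton[of x1] by (rule eventually_mono[rotated])
  qed
  finally show ?thesis .
qed

theorem theorem4p1:
  fixes \<epsilon> :: real
  assumes "0 < \<epsilon>" and "\<epsilon> \<le> 1"
  shows "khabibullin_counterexample 2 4 (S_eps \<epsilon>) \<and>
    (\<forall>x\<ge>0. 0 \<le> S_eps \<epsilon> x) \<and>
    mono_on {0..} (S_eps \<epsilon>) \<and>
    log_convex (S_eps \<epsilon>) \<and>
    (\<forall>t\<ge>0. (\<integral>\<^sup>+x\<in>{0..1}. ennreal (S_eps \<epsilon> (t * x) * x) \<partial>lborel) \<le> ennreal (t ^ 4)) \<and>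
    \<not> (\<integral>\<^sup>+t\<in>{0..}. ennreal (S_eps \<epsilon> t * (t ^ 7 / (1 + t ^ 8)\<^sup>2)) \<partial>lborel) \<le> ennreal (3 * pi / 8)"
proof -
  have nonneg: "\<forall>x\<ge>0. 0 \<le> S_eps \<epsilon> x"
    using S_gap_nonneg[OF assms] by (simp add: S_eps_eq_S_gap)
  have hyp: "\<forall>t\<ge>0. (\<integral>\<^sup>+x\<in>{0..1}. ennreal (S_eps \<epsilon> (t * x) * x) \<partial>lborel) \<le> ennreal (t ^ 4)"
    using S_eps_mean_le[OF assms] by simp
  have concl: "\<not> (\<integral>\<^sup>+t\<in>{0..}. ennreal (S_eps \<epsilon> t * (t ^ 7 / (1 + t ^ 8)\<^sup>2)) \<partial>lborel) \<le> ennreal (3 * pi / 8)"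
    using S_eps_integral_gt[OF assms] by (simp add: not_le)
  have "khabibullin_hypothesis 2 4 (S_eps \<epsilon>)"
    using hyp by (simp add: khabibullin_hypothesis_def)
  moreover have "\<not> khabibullin_conclusion 2 4 (S_eps \<epsilon>)"
  proof -
    have "(\<integral>\<^sup>+t\<in>{0..}. ennreal (S_eps \<epsilon> t * (t powr (2 * 4 - 1) / (1 + t powr (2 * 4))\<^sup>2)) \<partial>lborel)
        = (\<integral>\<^sup>+t\<in>{0..}. ennreal (S_eps \<epsilon> t * (t ^ 7 / (1 + t ^ 8)\<^sup>2)) \<partial>lborel)"
      by (intro nn_integral_cong) (simp split: split_indicator)
    then show ?thesis
      using concl by (simp add: khabibullin_conclusion_def mult.commute)
  qed
  ultimately show ?thesis
    using nonneg S_eps_mono[OF assms] S_eps_log_convex[OF assms] hyp concl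
    by (simp add: khabibullin_counterexample_def khabibullin_admissible_def)
qed

end
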